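(* Let $N\in\mathbb N$. For all $r,s,t,u\in\mathbb N$ with $r+s+t+u=N$, the following hold in the $\mathfrak{sl}_4(\mathbb C)$-module $P=\mathbb C[x,y,z,w]$: (i) $\mathcal P^\vee(s,t,u;A_1,A_2,A_3)\,x^N=x^ry^sz^tw^u$; (ii) $\mathcal P^\vee(s,t,u;A_1^*,A_2^*,A_3^* )\,x^{*N}=x^{*r}y^{*s}z^{*t}w^{*u}$.
   Context: $\mathbb N=\{0,1,2,\ldots\}$. With $E_{a,b}$ the $4\times4$ matrix units, define in $\mathfrak{sl}_4(\mathbb C)$: $A_1=E_{12}+E_{21}+E_{34}+E_{43}$, $A_2=E_{13}+E_{31}+E_{24}+E_{42}$, $A_3=E_{14}+E_{41}+E_{23}+E_{32}$, $A_1^*={\rm diag}(1,1,-1,-1)$, $A_2^*={\rm diag}(1,-1,1,-1)$, $A_3^*={\rm diag}(1,-1,-1,1)$. The $A_i$ mutually commute, and the $A_i^*$ mutually commute. $P=\mathbb C[x,y,z,w]$ is an $\mathfrak{sl}_4(\mathbb C)$-module on which every element acts as a derivation, and on the degree-one part $\varphi\in\mathfrak{sl}_4(\mathbb C)$ acts by its matrix with respect to the ordered basis $(v_1,v_2,v_3,v_4)=(x,y,z,w)$, i.e. $\varphi v_b=\sum_a\varphi_{ab}v_a$. Also $x^*=\frac{x+y+z+w}2$, $y^*=\frac{x+y-z-w}2$, $z^*=\frac{x-y+z-w}2$, $w^*=\frac{x-y-z+w}2$. For $n\in\mathbb N$, $(\alpha)_n=\alpha(\alpha+1)\cdots(\alpha+n-1)$.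 For commuting indeterminates $\lambda_1,\lambda_2,\lambda_3,\mu_1,\mu_2,\mu_3$ define the polynomial $$\mathcal P(\lambda_1,\lambda_2,\lambda_3;\mu_1,\mu_2,\mu_3)=\sum\frac{(-\lambda_1)_{a+b}(-\lambda_2)_{c+d}(-\lambda_3)_{e+f}(-\mu_1)_{c+e}(-\mu_2)_{a+f}(-\mu_3)_{b+d}}{(-N)_{a+b+c+d+e+f}}\,\frac{2^{a+b+c+d+e+f}}{a!\,b!\,c!\,d!\,e!\,f!},$$ the sum over $a,b,c,d,e,f\in\mathbb N$ with $a+b+c+d+e+f\le N$, and $$\mathcal P^\vee(\lambda_1,\lambda_2,\lambda_3;\mu_1,\mu_2,\mu_3)=\mathcal P\Bigl(\lambda_1,\lambda_2,\lambda_3;\tfrac{N+\mu_1-\mu_2-\mu_3}4,\tfrac{N-\mu_1+\mu_2-\mu_3}4,\tfrac{N-\mu_1-\mu_2+\mu_3}4\Bigr).$$ In the claim, the commuting operators by which $A_1,A_2,A_3$ (resp. $A_1^*,A_2^*,A_3^*$) act on $P$ are substituted for $\mu_1,\mu_2,\mu_3$, scalars being read as multiples of the identity. *)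

theory Defs
  imports "HOL-Analysis.Analysis" "HOL-Library.Poly_Mapping"
begin

text \<open>
  Finitely supported functions from exponent vectors to coefficients, with the convolution
  product of \<^theory>\<open>HOL-Library.Poly_Mapping\<close>.
\<close>

type_synonym 'i mpoly = "('i \<Rightarrow>\<^sub>0 nat) \<Rightarrow>\<^sub>0 complex"

definition Var :: "'i \<Rightarrow> 'i mpoly"
  where "Var i = Poly_Mapping.single (Poly_Mapping.single i 1) 1"

definition Const :: "complex \<Rightarrow> 'i mpoly"
  where "Const c = Poly_Mapping.single 0 c"

definition smul :: "complex \<Rightarrow> 'i mpoly \<Rightarrow> 'i mpoly"
  where "smul c p = Const c * p"

text \<open>
  The index type is \<open>4\<close>, so that \<open>4 = (0 :: 4)\<close> and the indices are \<open>1, 2, 3, 4\<close>.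
\<close>

type_synonym P = "4 mpoly"

definition sl4 :: "(complex^4^4) set"
  where "sl4 = {\<phi>. trace \<phi> = 0}"

definition E :: "4 \<Rightarrow> 4 \<Rightarrow> complex^4^4"
  where "E a b = (\<chi> i j. if i = a \<and> j = b then 1 else 0)"

definition A1 :: "complex^4^4" where "A1 = E 1 2 + E 2 1 + E 3 4 + E 4 3"
definition A2 :: "complex^4^4" where "A2 = E 1 3 + E 3 1 + E 2 4 + E 4 2"
definition A3 :: "complex^4^4" where "A3 = E 1 4 + E 4 1 + E 2 3 + E 3 2"

definition A1s :: "complex^4^4" where "A1s = E 1 1 + E 2 2 - E 3 3 - E 4 4"
definition A2s :: "complex^4^4" where "A2s = E 1 1 - E 2 2 + E 3 3 - E 4 4"
definition A3s :: "complex^4^4" where "A3s = E 1 1 - E 2 2 - E 3 3 + E 4 4"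

definition derivation :: "('i mpoly \<Rightarrow> 'i mpoly) \<Rightarrow> bool"
  where "derivation D \<longleftrightarrow>
    (\<forall>p q. D (p + q) = D p + D q) \<and>
    (\<forall>c p. D (smul c p) = smul c (D p)) \<and>
    (\<forall>p q. D (p * q) = D p * q + p * D q)"

text \<open>
  The derivation of \<open>P\<close> that acts on the degree-one part by the matrix \<open>\<phi>\<close>. Existence and
  uniqueness (\<open>ex1_derivation\<close>) and compatibility with the Lie bracket (\<open>act_bracket\<close>) are
  proved below; the definition makes sense for every matrix, not only for those in \<open>sl4\<close>.
\<close>

definition act :: "complex^4^4 \<Rightarrow> P \<Rightarrow> P"
  where "act \<phi> = (THE D. derivation D \<and> (\<forall>b. D (Var b) = (\<Sum>a\<in>UNIV. smul (\<phi> $ a $ b) (Var a))))"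

definition vx :: P where "vx = Var 1"
definition vy :: P where "vy = Var 2"
definition vz :: P where "vz = Var 3"
definition vw :: P where "vw = Var 4"

definition vxs :: P where "vxs = smul (1/2) (vx + vy + vz + vw)"
definition vys :: P where "vys = smul (1/2) (vx + vy - vz - vw)"
definition vzs :: P where "vzs = smul (1/2) (vx - vy + vz - vw)"
definition vws :: P where "vws = smul (1/2) (vx - vy - vz + vw)"

text \<open>
  The arguments of \<open>\<P>\<close> and \<open>\<P>\<^sup>\<or>\<close> are arbitrary polynomials, so that \<open>\<P>\<^sup>\<or>\<close> is literally \<open>\<P>\<close>
  with other arguments. \<open>pochhammer\<close> is the shifted factorial. The denominator
  \<open>(-N)\<^sub>k\<close> is nonzero because \<open>k \<le> N\<close>.
\<close>

definition calP ::
  "nat \<Rightarrow> 'i mpoly \<Rightarrow> 'i mpoly \<Rightarrow> 'i mpoly \<Rightarrow> 'i mpoly \<Rightarrow> 'i mpoly \<Rightarrow> 'i mpoly \<Rightarrow> 'i mpoly"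
  where "calP N l1 l2 l3 m1 m2 m3 =
    (\<Sum>(a, b, c, d, e, f) \<in> {(a, b, c, d, e, f). a + b + c + d + e + f \<le> N}.
      smul
        (2 ^ (a + b + c + d + e + f) /
          (pochhammer (- of_nat N) (a + b + c + d + e + f) *
            (fact a * fact b * fact c * fact d * fact e * fact f)))
        (pochhammer (- l1) (a + b) * pochhammer (- l2) (c + d) * pochhammer (- l3) (e + f) *
         pochhammer (- m1) (c + e) * pochhammer (- m2) (a + f) * pochhammer (- m3) (b + d)))"

definition calP_vee ::
  "nat \<Rightarrow> 'i mpoly \<Rightarrow> 'i mpoly \<Rightarrow> 'i mpoly \<Rightarrow> 'i mpoly \<Rightarrow> 'i mpoly \<Rightarrow> 'i mpoly \<Rightarrow> 'i mpoly"
  where "calP_vee N l1 l2 l3 m1 m2 m3 =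
    calP N l1 l2 l3
      (smul (1/4) (of_nat N + m1 - m2 - m3))
      (smul (1/4) (of_nat N - m1 + m2 - m3))
      (smul (1/4) (of_nat N - m1 - m2 + m3))"

datatype indet = Lam1 | Lam2 | Lam3 | Mu1 | Mu2 | Mu3

text \<open>
  Substitution of operators for the six indeterminates. The operators are meant to commute
  pairwise, which makes the order of composition within a monomial immaterial; for
  \<open>A1, A2, A3\<close> and \<open>A1s, A2s, A3s\<close> this is \<open>A_commute\<close> with \<open>act_commute\<close>.
\<close>

definition subst_monom :: "(indet \<Rightarrow> P \<Rightarrow> P) \<Rightarrow> (indet \<Rightarrow>\<^sub>0 nat) \<Rightarrow> P \<Rightarrow> P"
  where "subst_monom T m =
    (T Lam1 ^^ Poly_Mapping.lookup m Lam1) \<circ> (T Lam2 ^^ Poly_Mapping.lookup m Lam2) \<circ> (T Lam3 ^^ Poly_Mapping.lookup m Lam3) \<circ>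
    (T Mu1 ^^ Poly_Mapping.lookup m Mu1) \<circ> (T Mu2 ^^ Poly_Mapping.lookup m Mu2) \<circ> (T Mu3 ^^ Poly_Mapping.lookup m Mu3)"

definition subst_ops :: "(indet \<Rightarrow> P \<Rightarrow> P) \<Rightarrow> indet mpoly \<Rightarrow> P \<Rightarrow> P"
  where "subst_ops T p v = (\<Sum>m\<in>Poly_Mapping.keys p. smul (Poly_Mapping.lookup p m) (subst_monom T m v))"

text \<open>
  The scalars \<open>s, t, u\<close> enter as multiples of the identity operator.
\<close>

definition calP_vee_op ::
  "nat \<Rightarrow> complex \<Rightarrow> complex \<Rightarrow> complex \<Rightarrow> (P \<Rightarrow> P) \<Rightarrow> (P \<Rightarrow> P) \<Rightarrow> (P \<Rightarrow> P) \<Rightarrow> P \<Rightarrow> P"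
  where "calP_vee_op N s t u B1 B2 B3 =
    subst_ops
      (case_indet (smul s) (smul t) (smul u) B1 B2 B3)
      (calP_vee N (Var Lam1) (Var Lam2) (Var Lam3) (Var Mu1) (Var Mu2) (Var Mu3))"

lemma smul_single: "smul c (Poly_Mapping.single m d) = Poly_Mapping.single m (c * d)"
  by (simp add: smul_def Const_def mult_single)

lemma lookup_smult: "Poly_Mapping.lookup (smul c p) m = c * Poly_Mapping.lookup p m"
  unfolding smul_def Const_def mult_map_scale_conv_mult[symmetric]
  by (simp add: map.rep_eq when_def)

lemma smul_add: "smul c (p + q) = smul c p + smul c q"
  by (simp add: smul_def algebra_simps)

lemma smul_add_left: "smul (c + d) p = smul c p + smul d p"
  by (simp add: smul_def Const_def single_add algebra_simps)

lemma smul_smult: "smul c (smul d p) = smul (c * d) p"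
  by (simp add: smul_def Const_def mult.assoc[symmetric] mult_single)

lemma smul_mult_left: "smul c p * q = smul c (p * q)"
  by (simp add: smul_def mult.assoc)

lemma smul_mult_right: "p * smul c q = smul c (p * q)"
  by (simp add: smul_def mult.left_commute)

lemma smul_0 [simp]: "smul c 0 = 0" "smul 0 p = 0"
  by (simp_all add: smul_def Const_def)

lemma smul_1 [simp]: "smul 1 p = p"
  by (simp add: smul_def Const_def)

lemma smul_sum: "smul c (\<Sum>a\<in>S. g a) = (\<Sum>a\<in>S. smul c (g a))"
  by (simp add: smul_def sum_distrib_left)

lemma smul_sum_left: "smul (\<Sum>a\<in>S. g a) p = (\<Sum>a\<in>S. smul (g a) p)"
  by (induction S rule: infinite_finite_induct) (simp_all add: smul_add_left)

lemma poly_mapping_induct: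
  assumes "\<And>m c. Q (Poly_Mapping.single m c)" and "\<And>p q. Q p \<Longrightarrow> Q q \<Longrightarrow> Q (p + q)"
  shows "Q (p :: 'a \<Rightarrow>\<^sub>0 'b::comm_monoid_add)"
proof (induction p rule: update_induct)
  case const
  have "Q (Poly_Mapping.single undefined 0)" by (rule assms)
  then show ?case by simp
next
  case (update p a b)
  then have "Poly_Mapping.update a b p = p + Poly_Mapping.single a b"
    by (intro poly_mapping_eqI)
      (auto simp: lookup_add lookup_update lookup_single when_def in_keys_iff)
  with update assms show ?case by simp
qed

lemma mpoly_induct [case_names smul add one Var mult]:
  assumes "\<And>c p. Q p \<Longrightarrow> Q (smul c p)"
    and add: "\<And>p q. Q p \<Longrightarrow> Q q \<Longrightarrow> Q (p + q)"
    and one: "Q 1"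
    and Var: "\<And>i. Q (Var i)"
    and mult: "\<And>p q. Q p \<Longrightarrow> Q q \<Longrightarrow> Q (p * q)"
  shows "Q (p :: 'i mpoly)"
proof -
  have mono: "Q (Poly_Mapping.single m 1)" for m :: "'i \<Rightarrow>\<^sub>0 nat"
  proof (induction m rule: poly_mapping_induct)
    case (1 i n)
    show ?case
    proof (induction n)
      case 0
      then show ?case using one by simp
    next
      case (Suc n)
      have "(Poly_Mapping.single (Poly_Mapping.single i (Suc n)) 1 :: 'i mpoly)
          = Var i * Poly_Mapping.single (Poly_Mapping.single i n) 1"
        by (simp add: Var_def mult_single single_add[symmetric])
      with Suc Var mult show ?case by simp
    qed
  next
    case (2 m n)
    have "(Poly_Mapping.single (m + n) 1 :: 'i mpoly)
        = Poly_Mapping.single m 1 * Poly_Mapping.single n 1"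
      by (simp add: mult_single)
    with 2 mult show ?case by simp
  qed
  show ?thesis
  proof (induction p rule: poly_mapping_induct)
    case (1 m c)
    have "Poly_Mapping.single m c = smul c (Poly_Mapping.single m 1)"
      by (simp add: smul_single)
    with mono assms(1) show ?case by metis
  next
    case (2 p q)
    then show ?case by (rule add)
  qed
qed

lemma derivation_unique:
  assumes "derivation D" "derivation D'" and Var: "\<And>i. D (Var i) = D' (Var i)"
  shows "D = D'"
proof
  have F1: "F 1 = 0" if "derivation F" for F :: "'a mpoly \<Rightarrow> 'a mpoly"
  proof -
    have "F (1 * 1) = F 1 * 1 + 1 * F 1" using that unfolding derivation_def by blast
    then show ?thesis by simp
  qed
  fix p
  show "D p = D' p"
  proof (induction p rule: mpoly_induct)
    case one
    then show ?case using assms F1 by metis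
  qed (use assms in \<open>simp_all add: derivation_def\<close>)
qed

definition deriv_monom :: "('i::finite \<Rightarrow> 'i mpoly) \<Rightarrow> ('i \<Rightarrow>\<^sub>0 nat) \<Rightarrow> 'i mpoly"
  where "deriv_monom g m =
    (\<Sum>i\<in>UNIV. smul (of_nat (Poly_Mapping.lookup m i))
      (Poly_Mapping.single (m - Poly_Mapping.single i 1) 1 * g i))"

definition deriv_ext :: "('i::finite \<Rightarrow> 'i mpoly) \<Rightarrow> 'i mpoly \<Rightarrow> 'i mpoly"
  where "deriv_ext g p = (\<Sum>m\<in>Poly_Mapping.keys p. smul (Poly_Mapping.lookup p m) (deriv_monom g m))"

lemma deriv_ext_superset:
  assumes "finite S" "Poly_Mapping.keys p \<subseteq> S"
  shows "deriv_ext g p = (\<Sum>m\<in>S. smul (Poly_Mapping.lookup p m) (deriv_monom g m))"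
  unfolding deriv_ext_def using assms
  by (intro sum.mono_neutral_left) (auto simp: in_keys_iff)

lemma deriv_ext_add: "deriv_ext g (p + q) = deriv_ext g p + deriv_ext g q"
proof -
  let ?S = "Poly_Mapping.keys p \<union> Poly_Mapping.keys q"
  have "Poly_Mapping.keys (p + q) \<subseteq> ?S" by (rule keys_add)
  then show ?thesis
    by (simp add: deriv_ext_superset[of ?S] lookup_add smul_add_left sum.distrib)
qed

lemma deriv_ext_single: "deriv_ext g (Poly_Mapping.single m c) = smul c (deriv_monom g m)"
  by (simp add: deriv_ext_superset[of "{m}"])

lemma deriv_ext_smult: "deriv_ext g (smul c p) = smul c (deriv_ext g p)"
proof -
  have "Poly_Mapping.keys (smul c p) \<subseteq> Poly_Mapping.keys p" by (auto simp: in_keys_iff lookup_smult)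
  then show ?thesis
    by (simp add: deriv_ext_superset[of "Poly_Mapping.keys p"] lookup_smult smul_sum smul_smult)
qed

lemma deriv_monom_add:
  "deriv_monom g (m + n) =
    deriv_monom g m * Poly_Mapping.single n 1 + Poly_Mapping.single m 1 * deriv_monom g n"
proof -
  let ?e = "\<lambda>i. Poly_Mapping.single i (1::nat)"
  let ?X = "\<lambda>m. Poly_Mapping.single m (1::complex)"
  have shift: "smul (of_nat (Poly_Mapping.lookup m i)) (?X (m + n - ?e i)) =
      smul (of_nat (Poly_Mapping.lookup m i)) (?X (m - ?e i) * ?X n)" for m n and i :: 'a
  proof (cases "Poly_Mapping.lookup m i = 0")
    case False
    then have "m + n - ?e i = (m - ?e i) + n"
      by (intro poly_mapping_eqI) (auto simp: lookup_add lookup_minus lookup_single when_def)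
    then show ?thesis by (simp add: mult_single)
  qed simp
  have "smul (of_nat (Poly_Mapping.lookup (m + n) i)) (?X (m + n - ?e i) * g i) =
      smul (of_nat (Poly_Mapping.lookup m i)) (?X (m - ?e i) * g i) * ?X n +
      ?X m * smul (of_nat (Poly_Mapping.lookup n i)) (?X (n - ?e i) * g i)" for i
  proof -
    have "smul (of_nat (Poly_Mapping.lookup (m + n) i)) (?X (m + n - ?e i) * g i) =
        smul (of_nat (Poly_Mapping.lookup m i)) (?X (m + n - ?e i)) * g i +
        smul (of_nat (Poly_Mapping.lookup n i)) (?X (n + m - ?e i)) * g i"
      by (simp add: lookup_add smul_add_left smul_mult_left add.commute)
    then show ?thesis
      unfolding shift by (simp add: smul_mult_left smul_mult_right mult_ac)
  qed
  then show ?thesis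
    by (simp add: deriv_monom_def sum.distrib sum_distrib_left sum_distrib_right)
qed

lemma derivation_deriv_ext: "derivation (deriv_ext g)"
proof -
  have "deriv_ext g (p * q) = deriv_ext g p * q + p * deriv_ext g q" for p q
  proof (induction p rule: poly_mapping_induct)
    case (1 m c)
    show ?case
    proof (induction q rule: poly_mapping_induct)
      case (1 n d)
      have X: "(Poly_Mapping.single k a :: 'a mpoly) = smul a (Poly_Mapping.single k 1)" for k a
        by (simp add: smul_single)
      have "deriv_ext g (Poly_Mapping.single m c * Poly_Mapping.single n d) =
          smul (c * d) (deriv_monom g m * Poly_Mapping.single n 1 +
            Poly_Mapping.single m 1 * deriv_monom g n)"
        by (simp only: mult_single deriv_ext_single deriv_monom_add)
      moreover have "deriv_ext g (Poly_Mapping.single m c) * Poly_Mapping.single n d =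
          smul (c * d) (deriv_monom g m * Poly_Mapping.single n 1)"
        by (simp only: deriv_ext_single X[of n d] smul_mult_left smul_mult_right smul_smult mult.commute)
      moreover have "Poly_Mapping.single m c * deriv_ext g (Poly_Mapping.single n d) =
          smul (c * d) (Poly_Mapping.single m 1 * deriv_monom g n)"
        by (simp only: deriv_ext_single X[of m c] smul_mult_left smul_mult_right smul_smult mult.commute)
      ultimately show ?case by (simp only: smul_add)
    next
      case (2 p q)
      then show ?case by (simp add: algebra_simps deriv_ext_add)
    qed
  next
    case (2 p p')
    then show ?case by (simp add: algebra_simps deriv_ext_add)
  qed
  then show ?thesis by (simp add: derivation_def deriv_ext_add deriv_ext_smult)
qed

lemma deriv_ext_Var: "deriv_ext g (Var i) = g i"
proof -
  have "deriv_ext g (Var i) =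
      (\<Sum>j\<in>UNIV. if j = i then g i else 0)"
    unfolding Var_def deriv_ext_single smul_1 deriv_monom_def
    by (intro sum.cong) (auto simp: lookup_single when_def)
  then show ?thesis by simp
qed

lemma ex1_derivation: "\<exists>!D. derivation D \<and> (\<forall>i. D (Var i) = g i)" for g :: "'i::finite \<Rightarrow> 'i mpoly"
proof (rule ex1I)
  show "derivation (deriv_ext g) \<and> (\<forall>i. deriv_ext g (Var i) = g i)"
    by (simp add: derivation_deriv_ext deriv_ext_Var)
  then show "D = deriv_ext g" if "derivation D \<and> (\<forall>i. D (Var i) = g i)" for D
    using that by (intro derivation_unique) auto
qed

lemma derivation_act: "derivation (act \<phi>)"
  and act_Var: "act \<phi> (Var b) = (\<Sum>a\<in>UNIV. smul (\<phi> $ a $ b) (Var a))"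
  using theI'[OF ex1_derivation[of "\<lambda>b. \<Sum>a\<in>UNIV. smul (\<phi> $ a $ b) (Var a)"]]
  unfolding act_def by blast+

lemma act_add_right: "act \<phi> (p + q) = act \<phi> p + act \<phi> q"
  and act_smult_right: "act \<phi> (smul c p) = smul c (act \<phi> p)"
  and act_mult: "act \<phi> (p * q) = act \<phi> p * q + p * act \<phi> q"
  using derivation_act[of \<phi>] unfolding derivation_def by blast+

lemma act_sum_right: "act \<phi> (\<Sum>a\<in>S. g a) = (\<Sum>a\<in>S. act \<phi> (g a))"
proof (induction S rule: infinite_finite_induct)
  have "act \<phi> 0 = 0" using act_smult_right[of \<phi> 0 0] by simp
  then show "act \<phi> (sum g S) = (\<Sum>a\<in>S. act \<phi> (g a))" if "infinite S" for S using that by simp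
  show "act \<phi> (sum g {}) = (\<Sum>a\<in>{}. act \<phi> (g a))" using \<open>act \<phi> 0 = 0\<close> by simp
qed (simp add: act_add_right)

lemma act_add_left: "act (\<phi> + \<psi>) p = act \<phi> p + act \<psi> p"
proof -
  have "act (\<phi> + \<psi>) = (\<lambda>p. act \<phi> p + act \<psi> p)"
  proof (rule derivation_unique)
    show "derivation (\<lambda>p. act \<phi> p + act \<psi> p)"
      by (simp add: derivation_def act_add_right act_smult_right act_mult smul_add algebra_simps)
  qed (simp_all add: derivation_act act_Var smul_add_left sum.distrib)
  then show ?thesis by simp
qed

lemma act_scale_left: "act (\<chi> i j. c * \<phi> $ i $ j) p = smul c (act \<phi> p)"
proof -
  have "act (\<chi> i j. c * \<phi> $ i $ j) = (\<lambda>p. smul c (act \<phi> p))"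
  proof (rule derivation_unique)
    show "derivation (\<lambda>p. smul c (act \<phi> p))"
      by (simp add: derivation_def act_add_right act_smult_right act_mult smul_add
          smul_smult smul_mult_left smul_mult_right mult.commute)
  qed (simp_all add: derivation_act act_Var smul_smult smul_sum)
  then show ?thesis by simp
qed

lemma act_act_Var: "act \<phi> (act \<psi> (Var b)) = (\<Sum>a\<in>UNIV. smul ((\<phi> ** \<psi>) $ a $ b) (Var a))"
proof -
  have "act \<phi> (act \<psi> (Var b)) =
      (\<Sum>k\<in>UNIV. \<Sum>a\<in>UNIV. smul (\<phi> $ a $ k * \<psi> $ k $ b) (Var a))"
    by (simp add: act_Var act_sum_right act_smult_right smul_sum smul_smult mult.commute)
  also have "\<dots> = (\<Sum>a\<in>UNIV. \<Sum>k\<in>UNIV. smul (\<phi> $ a $ k * \<psi> $ k $ b) (Var a))"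
    by (rule sum.swap)
  finally show ?thesis by (simp add: matrix_matrix_mult_def smul_sum_left)
qed

lemma act_bracket: "act (\<phi> ** \<psi> - \<psi> ** \<phi>) p = act \<phi> (act \<psi> p) - act \<psi> (act \<phi> p)"
proof -
  have sm: "smul c (p - q) = smul c p - smul c q" for c and p q :: P
    by (simp add: smul_def algebra_simps)
  have sm': "smul (c - d) p = smul c p - smul d p" for c d and p :: P
    by (simp add: smul_def Const_def single_diff algebra_simps)
  have "act (\<phi> ** \<psi> - \<psi> ** \<phi>) = (\<lambda>p. act \<phi> (act \<psi> p) - act \<psi> (act \<phi> p))"
  proof (rule derivation_unique)
    show "derivation (\<lambda>p. act \<phi> (act \<psi> p) - act \<psi> (act \<phi> p))"
      by (simp add: derivation_def act_add_right act_smult_right act_mult sm algebra_simps)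
  next
    fix b :: 4
    show "act (\<phi> ** \<psi> - \<psi> ** \<phi>) (Var b) = act \<phi> (act \<psi> (Var b)) - act \<psi> (act \<phi> (Var b))"
      by (simp only: act_act_Var act_Var[of "\<phi> ** \<psi> - \<psi> ** \<phi>"])
        (simp add: sm' sum_subtractf)
  qed (rule derivation_act)
  then show ?thesis by simp
qed

lemma A_in_sl4: "A1 \<in> sl4" "A2 \<in> sl4" "A3 \<in> sl4" "A1s \<in> sl4" "A2s \<in> sl4" "A3s \<in> sl4"
  by (simp_all add: sl4_def trace_def sum_4 E_def A1_def A2_def A3_def A1s_def A2s_def A3s_def)

lemma A_commute:
  "A1 ** A2 = A2 ** A1" "A1 ** A3 = A3 ** A1" "A2 ** A3 = A3 ** A2"
  "A1s ** A2s = A2s ** A1s" "A1s ** A3s = A3s ** A1s" "A2s ** A3s = A3s ** A2s"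
  by (simp_all add: vec_eq_iff matrix_matrix_mult_def forall_4 sum_4 E_def
      A1_def A2_def A3_def A1s_def A2s_def A3s_def)

lemma act_commute: "\<phi> ** \<psi> = \<psi> ** \<phi> \<Longrightarrow> act \<phi> (act \<psi> p) = act \<psi> (act \<phi> p)"
proof -
  assume *: "\<phi> ** \<psi> = \<psi> ** \<phi>"
  have "act 0 p = 0" using act_add_left[of 0 0 p] by simp
  with act_bracket[of \<phi> \<psi> p] * show ?thesis by simp
qed

end

(*
  Each of the two claims is the same statement about three commuting derivations D1, D2, D3 with
  common eigenvectors X1, ..., X4 (eigenvalues +-1) and the form X = (X1 + X2 + X3 + X4)/2.  In
  degree N the operators substituted for the mu-arguments of P, such as (N + D1 - D2 - D3)/4, are
  the partial Euler operators X_i d/dX_i for i = 2, 3, 4.  Hence (-M_i)_k is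
  (-1)^k X_i^k (d/dX_i)^k, and the product of the three shifted factorials sends X^N to
  (-N)_n 2^(-n) X^(N-n) times a monomial in X2, X3, X4, where n is the sum of the summation
  indices.  This cancels the denominator (-N)_n and the factor 2^n, so the sum splits into three
  trinomial expansions and equals
  X^r (X - X3 - X4)^s (X - X2 - X4)^t (X - X2 - X3)^u.
*)

theory Submission
  imports Defs
begin

section \<open>Constants and scalar multiples\<close>

lemma Const_add: "Const (c + d) = Const c + Const d"
  by (simp add: Const_def single_add)

lemma Const_uminus: "Const (- c) = - Const c"
  by (simp add: Const_def single_uminus)

lemma Const_diff: "Const (c - d) = Const c - Const d"
  by (simp add: Const_def single_diff)

lemma Const_mult: "Const (c * d) = Const c * Const d"
  by (simp add: Const_def mult_single)

lemma Const_1: "Const 1 = 1"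
  by (simp add: Const_def)

lemma Const_of_nat: "Const (of_nat n) = of_nat n"
  by (induction n) (simp_all add: Const_add Const_1, simp add: Const_def)

lemma of_nat_mult_eq_smul: "of_nat n * p = smul (of_nat n) p"
  by (simp add: smul_def Const_of_nat)

lemma smul_uminus: "smul c (- p) = - smul c p"
  by (simp add: smul_def)

lemma smul_minus_left: "smul (- c) p = - smul c p"
  by (simp add: smul_def Const_uminus)

lemma smul_diff: "smul c (p - q) = smul c p - smul c q"
  by (simp add: smul_def algebra_simps)

lemma smul_diff_left: "smul (c - d) p = smul c p - smul d p"
  using smul_add_left[of c "- d" p] by (simp add: smul_minus_left)

lemma power_uminus_eq_smul: "(- p) ^ k = smul ((- 1) ^ k) (p ^ k)"
  by (induction k) (simp_all add: smul_mult_right smul_minus_left smul_uminus)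

section \<open>Substitution of operators for indeterminates\<close>

lemma subst_ops_superset:
  assumes "finite S" "Poly_Mapping.keys p \<subseteq> S"
  shows "subst_ops T p v = (\<Sum>m\<in>S. smul (Poly_Mapping.lookup p m) (subst_monom T m v))"
  unfolding subst_ops_def using assms
  by (intro sum.mono_neutral_left) (auto simp: in_keys_iff)

lemma subst_ops_add: "subst_ops T (p + q) v = subst_ops T p v + subst_ops T q v"
proof -
  let ?S = "Poly_Mapping.keys p \<union> Poly_Mapping.keys q"
  have "Poly_Mapping.keys (p + q) \<subseteq> ?S" by (rule keys_add)
  then show ?thesis
    by (simp add: subst_ops_superset[of ?S] lookup_add smul_add_left sum.distrib)
qed

lemma subst_ops_smul: "subst_ops T (smul c p) v = smul c (subst_ops T p v)"
proof -
  have "Poly_Mapping.keys (smul c p) \<subseteq> Poly_Mapping.keys p"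
    by (auto simp: in_keys_iff lookup_smult)
  then show ?thesis
    by (simp add: subst_ops_superset[of "Poly_Mapping.keys p"] lookup_smult smul_sum smul_smult)
qed

lemma subst_ops_zero: "subst_ops T 0 v = 0"
  by (simp add: subst_ops_def)

lemma subst_ops_single: "subst_ops T (Poly_Mapping.single m c) v = smul c (subst_monom T m v)"
  by (simp add: subst_ops_superset[of "{m}"])

lemma subst_ops_one: "subst_ops T 1 v = v"
  using subst_ops_single[of T 0 1 v] by (simp add: subst_monom_def)

lemma subst_ops_of_nat: "subst_ops T (of_nat n) v = of_nat n * v"
  by (induction n) (simp_all add: subst_ops_zero subst_ops_add subst_ops_one algebra_simps)

lemma subst_ops_uminus: "subst_ops T (- p) v = - subst_ops T p v"
  using subst_ops_smul[of T "-1" p v] by (simp add: smul_minus_left)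

lemma subst_ops_diff: "subst_ops T (p - q) v = subst_ops T p v - subst_ops T q v"
  using subst_ops_add[of T p "- q" v] by (simp add: subst_ops_uminus)

lemma subst_ops_sum: "subst_ops T (\<Sum>a\<in>S. g a) v = (\<Sum>a\<in>S. subst_ops T (g a) v)"
  by (induction S rule: infinite_finite_induct) (simp_all add: subst_ops_zero subst_ops_add)

lemma subst_ops_Var: "subst_ops T (Var i) v = T i v"
  by (cases i) (simp_all add: Var_def subst_ops_single subst_monom_def lookup_single when_def)

locale commuting_operators =
  fixes T :: "indet \<Rightarrow> P \<Rightarrow> P"
  assumes T_add: "T i (p + q) = T i p + T i q"
    and T_smul: "T i (smul c p) = smul c (T i p)"
    and T_commute: "T i (T j p) = T j (T i p)"
begin

lemma T_funpow_commute: "(T j ^^ n) (T i p) = T i ((T j ^^ n) p)"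
  by (induction n) (simp_all add: T_commute)

text \<open>\<open>subst_monom\<close> composes in a fixed order of the indeterminates, so the new
  factor appears next to its own power; commutativity carries it outwards past the powers applied
  later.\<close>

lemma subst_monom_Var: "subst_monom T (Poly_Mapping.single i 1 + m) v = T i (subst_monom T m v)"
  by (cases i) (simp_all add: subst_monom_def lookup_add lookup_single when_def T_funpow_commute)

lemma subst_ops_Var_mult: "subst_ops T (Var i * q) v = T i (subst_ops T q v)"
proof (induction q rule: poly_mapping_induct)
  case (1 m c)
  then show ?case
    using subst_monom_Var[of i m v] by (simp add: Var_def mult_single subst_ops_single T_smul)
next
  case (2 p q)
  then show ?case by (simp add: distrib_left subst_ops_add T_add)
qed

text \<open>Multiplicativity allows the six shifted factorials of a summand of \<open>calP\<close>
  to be applied one after another, and linearity in the vector pulls out the scalars met on the way.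
  The product case of linearity rests on \<open>mult\<close>, which therefore comes first.\<close>

lemma subst_ops_apply_smul: "subst_ops T p (smul c v) = smul c (subst_ops T p v)"
  and subst_ops_mult: "subst_ops T (p * q) u = subst_ops T p (subst_ops T q u)"
proof -
  have mult: "subst_ops T (p * q) u = subst_ops T p (subst_ops T q u)" for p q u
  proof (induction p arbitrary: q u rule: mpoly_induct)
    case (mult p p')
    then show ?case by (simp add: mult.assoc)
  qed (simp_all add: smul_mult_left subst_ops_smul distrib_right subst_ops_add subst_ops_one
      subst_ops_Var_mult subst_ops_Var)
  then show "subst_ops T (p * q) u = subst_ops T p (subst_ops T q u)" .
  show "subst_ops T p (smul c v) = smul c (subst_ops T p v)"
    by (induction p arbitrary: v rule: mpoly_induct)
      (simp_all add: mult subst_ops_smul subst_ops_add subst_ops_one subst_ops_Var T_smul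
        smul_smult smul_add mult.commute)
qed

lemma subst_ops_pochhammer_scalar:
  assumes "\<And>p. T i p = smul c p"
  shows "subst_ops T (pochhammer (- Var i) k) v = smul (pochhammer (- c) k) v"
proof (induction k arbitrary: v)
  case 0
  then show ?case by (simp add: subst_ops_one)
next
  case (Suc k)
  have "subst_ops T (of_nat k - Var i) v = smul (of_nat k - c) v"
    by (simp add: subst_ops_diff subst_ops_Var assms subst_ops_of_nat
        of_nat_mult_eq_smul smul_diff_left)
  with Suc show ?case
    by (simp add: pochhammer_Suc subst_ops_mult subst_ops_apply_smul smul_smult mult.commute)
qed

end

section \<open>Derivations and partial Euler operators\<close>

lemma derivation_add: "derivation D \<Longrightarrow> D (p + q) = D p + D q"
  and derivation_smul: "derivation D \<Longrightarrow> D (smul c p) = smul c (D p)"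
  and derivation_mult: "derivation D \<Longrightarrow> D (p * q) = D p * q + p * D q"
  by (simp_all add: derivation_def)

lemma derivation_one: "derivation D \<Longrightarrow> D 1 = 0"
  using derivation_mult[of D 1 1] by simp

lemma derivation_power: "derivation D \<Longrightarrow> D (p ^ n) = of_nat n * p ^ (n - 1) * D p"
proof (induction n)
  case (Suc n)
  then show ?case by (cases n) (simp_all add: derivation_mult derivation_one algebra_simps)
qed (simp add: derivation_one)

lemma derivation_power_eigen:
  assumes "derivation D" "D p = smul c p"
  shows "D (p ^ n) = smul (of_nat n * c) (p ^ n)"
  unfolding derivation_power[OF assms(1)] assms(2)
  by (cases n) (simp_all add: of_nat_mult_eq_smul smul_mult_left smul_mult_right smul_smult mult_ac
      del: of_nat_Suc)

text \<open>
  On forms of degree \<open>N\<close> in \<open>Y, Z, W\<close> and \<open>2X - Y - Z - W\<close>, the operator \<open>(N + G)/4\<close> is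
  the partial Euler operator of \<open>Y\<close>.
\<close>

lemma partial_Euler_monomial:
  assumes G: "derivation G" "G X = smul 2 Y - X" "G Y = smul 3 Y" "G Z = - Z" "G W = - W"
    and N: "i + a + b + c = N"
  shows "smul (1/4) (of_nat N * (X ^ i * Y ^ a * Z ^ b * W ^ c) + G (X ^ i * Y ^ a * Z ^ b * W ^ c))
    = smul (of_nat a) (X ^ i * Y ^ a * Z ^ b * W ^ c)
      + smul (of_nat i / 2) (X ^ (i - 1) * Y ^ Suc a * Z ^ b * W ^ c)"
proof -
  have Y: "G (Y ^ a) = smul (of_nat a * 3) (Y ^ a)"
    by (rule derivation_power_eigen[OF G(1,3)])
  have Z: "G (Z ^ b) = smul (- of_nat b) (Z ^ b)"
    using derivation_power_eigen[OF G(1), of Z "-1"] by (simp add: G smul_minus_left)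
  have W: "G (W ^ c) = smul (- of_nat c) (W ^ c)"
    using derivation_power_eigen[OF G(1), of W "-1"] by (simp add: G smul_minus_left)
  \<comment> \<open>Each application of \<open>G\<close> trades one factor \<open>X\<close> for
    \<open>2Y - X\<close>. For \<open>i = 0\<close> the truncated exponent \<open>i - 1\<close> does
    no harm, since its coefficient is zero.\<close>
  have X: "G (X ^ i) = smul (of_nat i * 2) (X ^ (i - 1) * Y) - smul (of_nat i) (X ^ i)"
    unfolding derivation_power[OF G(1)] G(2)
    by (cases i) (simp_all add: of_nat_mult_eq_smul smul_mult_left smul_mult_right smul_smult
        right_diff_distrib smul_diff mult_ac del: of_nat_Suc)
  let ?F = "X ^ i * Y ^ a * Z ^ b * W ^ c" and ?F' = "X ^ (i - 1) * Y ^ Suc a * Z ^ b * W ^ c"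
  have "of_nat N * ?F + G ?F
    = smul (of_nat N + of_nat a * 3 - of_nat i - of_nat b - of_nat c) ?F + smul (of_nat i * 2) ?F'"
    unfolding derivation_mult[OF G(1)] X Y Z W smul_def Const_add Const_diff Const_uminus Const_mult
      Const_of_nat power_Suc
    by (simp add: algebra_simps)
  \<comment> \<open>Inserting \<open>N = i + a + b + c\<close> cancels every exponent except that of
    \<open>Y\<close>, the only one whose eigenvalue is 3 rather than -1.\<close>
  also have "of_nat N + of_nat a * 3 - of_nat i - of_nat b - of_nat c = (4 * of_nat a :: complex)"
    by (simp flip: N)
  finally show ?thesis
    by (simp add: smul_add smul_smult)
qed

text \<open>The starting monomial contains no \<open>Y\<close>, and every factor of the shifted
  factorial adds one. When the factor \<open>k - H\<close> is reached the exponent of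
  \<open>Y\<close> is \<open>k\<close>, so it cancels the diagonal part of \<open>H\<close>; only
  the term that turns another \<open>X\<close> into \<open>Y\<close> survives, with coefficient
  \<open>-(i - k)/2\<close>.\<close>

lemma (in commuting_operators) pochhammer_partial_Euler:
  assumes G: "derivation G" "G X = smul 2 Y - X" "G Y = smul 3 Y" "G Z = - Z" "G W = - W"
    and H: "\<And>v. subst_ops T H v = smul (1/4) (of_nat N * v + G v)"
    and N: "i + b + c = N"
  shows "subst_ops T (pochhammer (- H) k) (X ^ i * Z ^ b * W ^ c)
    = smul (pochhammer (- of_nat i) k / 2 ^ k) (X ^ (i - k) * Y ^ k * Z ^ b * W ^ c)"
proof (induction k)
  case 0
  then show ?case by (simp add: subst_ops_one)
next
  case (Suc k)
  let ?F = "X ^ (i - k) * Y ^ k * Z ^ b * W ^ c"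
  let ?F' = "X ^ (i - Suc k) * Y ^ Suc k * Z ^ b * W ^ c"
  have "subst_ops T (pochhammer (- H) (Suc k)) (X ^ i * Z ^ b * W ^ c)
    = smul (pochhammer (- of_nat i) k / 2 ^ k) (subst_ops T (of_nat k - H) ?F)"
    by (simp add: pochhammer_Suc mult.commute[of _ "of_nat k - H"] subst_ops_mult Suc
        subst_ops_apply_smul)
  also have "\<dots> = smul (pochhammer (- of_nat i) (Suc k) / 2 ^ Suc k) ?F'"
  proof (cases "k \<le> i")
    case True
    then have "subst_ops T H ?F = smul (of_nat k) ?F + smul (of_nat (i - k) / 2) ?F'"
      using partial_Euler_monomial[OF G, of "i - k" k b c N] N by (simp add: H)
    then have "subst_ops T (of_nat k - H) ?F = smul (- of_nat (i - k) / 2) ?F'"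
      by (simp add: subst_ops_diff subst_ops_of_nat of_nat_mult_eq_smul smul_minus_left)
    with True show ?thesis
      by (simp add: smul_smult pochhammer_Suc of_nat_diff field_simps)
  next
    \<comment> \<open>Once \<open>k > i\<close> no \<open>X\<close> is left to convert; both
      coefficients vanish, so the truncated exponents of \<open>X\<close> are irrelevant.\<close>
    case False
    then have "pochhammer (- of_nat i :: complex) k = 0" "pochhammer (- of_nat i :: complex) (Suc k) = 0"
      by (auto simp: pochhammer_of_nat_eq_0_iff)
    then show ?thesis by simp
  qed
  finally show ?case .
qed

section \<open>Trinomial expansions and the sixfold sum\<close>

lemma pochhammer_uminus_of_nat_div_fact:
  "pochhammer (- of_nat s) k / fact k = (- 1) ^ k * (of_nat (s choose k) :: complex)"
  by (simp add: binomial_gbinomial gbinomial_pochhammer)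

text \<open>The binomial theorem is applied twice, first to \<open>-(Y + Z) + X\<close> and then to
  \<open>(Y + Z) ^ k\<close>. The quotient of \<open>(-s)_k\<close> by \<open>k!\<close> is the
  binomial coefficient together with the sign of \<open>(-(Y + Z)) ^ k\<close>.\<close>

lemma trinomial_pochhammer:
  "(\<Sum>(a, b)\<in>{(a, b). a + b \<le> s}.
      smul (pochhammer (- of_nat s) (a + b) / (fact a * fact b)) (X ^ (s - (a + b)) * Y ^ a * Z ^ b))
    = (X - Y - Z) ^ s"
proof -
  have "(X - Y - Z) ^ s = (- (Y + Z) + X) ^ s"
    by (simp add: algebra_simps)
  also have "\<dots> = (\<Sum>k\<le>s. smul (pochhammer (- of_nat s) k / fact k) (X ^ (s - k) * (Y + Z) ^ k))"
    unfolding binomial_ring[of "- (Y + Z)"] power_uminus_eq_smul pochhammer_uminus_of_nat_div_fact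
      of_nat_mult_eq_smul smul_mult_left smul_mult_right smul_smult
    by (simp only: mult.commute)
  also have "\<dots> = (\<Sum>k\<le>s. \<Sum>a\<le>k.
      smul (pochhammer (- of_nat s) k / (fact a * fact (k - a))) (X ^ (s - k) * Y ^ a * Z ^ (k - a)))"
  proof (rule sum.cong[OF refl])
    fix k
    show "smul (pochhammer (- of_nat s) k / fact k) (X ^ (s - k) * (Y + Z) ^ k) = (\<Sum>a\<le>k.
      smul (pochhammer (- of_nat s) k / (fact a * fact (k - a))) (X ^ (s - k) * Y ^ a * Z ^ (k - a)))"
      unfolding binomial_ring sum_distrib_left smul_sum
      by (intro sum.cong)
        (simp_all add: binomial_fact of_nat_mult_eq_smul smul_mult_left smul_mult_right smul_smult mult.assoc)
  qed
  also have "\<dots> = (\<Sum>(a, b)\<in>{(a, b). a + b \<le> s}.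
      smul (pochhammer (- of_nat s) (a + b) / (fact a * fact b)) (X ^ (s - (a + b)) * Y ^ a * Z ^ b))"
    unfolding sum.Sigma[OF finite_atMost ballI[OF finite_atMost]]
    by (rule sum.reindex_bij_witness[where i = "\<lambda>(a, b). (a + b, a)" and j = "\<lambda>(k, a). (a, k - a)"]) auto
  finally show ?thesis ..
qed

lemma sum_product_triple:
  fixes f :: "'a \<Rightarrow> 'd :: comm_semiring_0"
  shows "sum f A * sum g B * sum h C = (\<Sum>(p, q, w)\<in>A \<times> B \<times> C. f p * g q * h w)"
  unfolding mult.assoc by (simp only: sum_product sum.cartesian_product) (simp add: split_def)

text \<open>The grouping \<open>C * F\<close>, \<open>A * G\<close>, \<open>B * D\<close>
  anticipates the exponents \<open>c + e\<close>, \<open>a + f\<close>, \<open>b + d\<close>: each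
  of the three variables occurs in two of the three trinomials.\<close>

lemma smul_prod_trinomial_terms:
  "smul (p / (a * b)) (X1 * A * B) * smul (q / (c * d)) (X2 * C * D) * smul (r / (e * f)) (X3 * F * G)
    = smul (p * q * r / (a * b * c * d * e * f)) (X1 * X2 * X3 * (C * F) * (A * G) * (B * D))"
  by (simp add: smul_mult_left smul_mult_right smul_smult mult_ac)

text \<open>The shifted factorials of \<open>-s\<close>, \<open>-t\<close>, \<open>-u\<close> vanish
  unless \<open>a + b \<le> s\<close>, \<open>c + d \<le> t\<close> and
  \<open>e + f \<le> u\<close>. This replaces the single bound by \<open>N\<close> with three
  independent ones, and the sum factors.\<close>

lemma sum_trinomial_pochhammer_product:
  assumes N: "r + s + t + u = N"
  shows "(\<Sum>(a, b, c, d, e, f) \<in> {(a, b, c, d, e, f). a + b + c + d + e + f \<le> N}.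
      smul (pochhammer (- of_nat s) (a + b) * pochhammer (- of_nat t) (c + d) * pochhammer (- of_nat u) (e + f)
          / (fact a * fact b * fact c * fact d * fact e * fact f))
        (X ^ (N - (a + b + c + d + e + f)) * Y ^ (c + e) * Z ^ (a + f) * W ^ (b + d)))
    = X ^ r * (X - Z - W) ^ s * (X - Y - W) ^ t * (X - Y - Z) ^ u"
    (is "sum ?h ?S = _")
proof -
  let ?T = "\<lambda>n :: nat. {(a, b). a + b \<le> n}"
  let ?g = "\<lambda>n Y Z (a, b). smul (pochhammer (- of_nat n) (a + b) / (fact a * fact b))
      (X ^ (n - (a + b)) * Y ^ a * Z ^ b)"
  let ?S' = "(\<lambda>((a, b), (c, d), (e, f)). (a, b, c, d, e, f)) ` (?T s \<times> ?T t \<times> ?T u)"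
  have fin: "finite ?S"
    by (rule finite_subset[of _ "{..N} \<times> {..N} \<times> {..N} \<times> {..N} \<times> {..N} \<times> {..N}"]) auto
  have zero: "\<not> k \<le> n \<Longrightarrow> pochhammer (- of_nat n :: complex) k = 0" for k n
    by (simp add: pochhammer_of_nat_eq_0_iff)
  have "sum ?h ?S = sum ?h ?S'"
  proof (rule sum.mono_neutral_right[OF fin])
    show "?S' \<subseteq> ?S"
      using N by auto
    show "\<forall>i\<in>?S - ?S'. ?h i = 0"
    proof
      fix p
      assume p: "p \<in> ?S - ?S'"
      obtain a b c d e f where p_eq: "p = (a, b, c, d, e, f)"
        by (cases p)
      with p have "\<not> (a + b \<le> s \<and> c + d \<le> t \<and> e + f \<le> u)"
        by (force simp: image_iff)
      then show "?h p = 0"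
        using p_eq zero[of "a + b" s] zero[of "c + d" t] zero[of "e + f" u] by auto
    qed
  qed
  also have "\<dots> = (\<Sum>((a, b), (c, d), (e, f))\<in>?T s \<times> ?T t \<times> ?T u. ?h (a, b, c, d, e, f))"
    by (subst sum.reindex) (auto simp: inj_on_def intro!: sum.cong)
  also have "\<dots> = (\<Sum>(p, q, w)\<in>?T s \<times> ?T t \<times> ?T u. X ^ r * (?g s Z W p * ?g t Y W q * ?g u Y Z w))"
  proof (rule sum.cong[OF refl])
    fix x
    assume x: "x \<in> ?T s \<times> ?T t \<times> ?T u"
    obtain a b c d e f where x_eq: "x = ((a, b), (c, d), (e, f))"
      by (metis surj_pair)
    \<comment> \<open>Under the three bounds no subtraction is truncated; the surplus
      \<open>r\<close> yields the common factor \<open>X ^ r\<close>.\<close>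
    have "N - (a + b + c + d + e + f) = r + (s - (a + b)) + (t - (c + d)) + (u - (e + f))"
      using N x x_eq by simp
    then show "(\<lambda>((a, b), (c, d), (e, f)). ?h (a, b, c, d, e, f)) x
        = (\<lambda>(p, q, w). X ^ r * (?g s Z W p * ?g t Y W q * ?g u Y Z w)) x"
      unfolding x_eq prod.case smul_prod_trinomial_terms
      by (simp add: power_add smul_mult_right mult.assoc)
  qed
  also have "\<dots> = X ^ r * (sum (?g s Z W) (?T s) * sum (?g t Y W) (?T t) * sum (?g u Y Z) (?T u))"
    unfolding sum_product_triple by (simp add: sum_distrib_left split_def)
  also have "\<dots> = X ^ r * (X - Z - W) ^ s * (X - Y - W) ^ t * (X - Y - Z) ^ u"
    unfolding trinomial_pochhammer by (simp only: mult.assoc)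
  finally show ?thesis .
qed

section \<open>Evaluation for commuting derivations with common eigenvectors\<close>

text \<open>The three differences on the right are \<open>D1 X\<close>, \<open>D2 X\<close> and
  \<open>D3 X\<close>, which are the remaining coordinates of the system containing
  \<open>X\<close>.\<close>

lemma calP_vee_op_power:
  fixes X X1 X2 X3 X4 :: P
  assumes D: "derivation D1" "derivation D2" "derivation D3"
    and comm: "\<And>p. D1 (D2 p) = D2 (D1 p)" "\<And>p. D1 (D3 p) = D3 (D1 p)" "\<And>p. D2 (D3 p) = D3 (D2 p)"
    and D1: "D1 X1 = X1" "D1 X2 = X2" "D1 X3 = - X3" "D1 X4 = - X4"
    and D2: "D2 X1 = X1" "D2 X2 = - X2" "D2 X3 = X3" "D2 X4 = - X4"
    and D3: "D3 X1 = X1" "D3 X2 = - X2" "D3 X3 = - X3" "D3 X4 = X4"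
    and X: "X = smul (1/2) (X1 + X2 + X3 + X4)"
    and N: "r + s + t + u = N"
  shows "calP_vee_op N (of_nat s) (of_nat t) (of_nat u) D1 D2 D3 (X ^ N)
    = X ^ r * (X - X3 - X4) ^ s * (X - X2 - X4) ^ t * (X - X2 - X3) ^ u"
proof -
  define T :: "indet \<Rightarrow> P \<Rightarrow> P"
    where "T = case_indet (smul (of_nat s)) (smul (of_nat t)) (smul (of_nat u)) D1 D2 D3"
  interpret commuting_operators T
  proof
    show "T i (p + q) = T i p + T i q" for i p q
      using D by (cases i) (simp_all add: T_def smul_add derivation_add)
    show "T i (smul c p) = smul c (T i p)" for i c p
      using D by (cases i) (simp_all add: T_def derivation_smul smul_smult mult.commute)
    show "T i (T j p) = T j (T i p)" for i j p
      using D comm by (cases i; cases j) (simp_all add: T_def derivation_smul smul_smult mult.commute)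
  qed
  let ?H1 = "smul (1/4) (of_nat N + Var Mu1 - Var Mu2 - Var Mu3)"
  let ?H2 = "smul (1/4) (of_nat N - Var Mu1 + Var Mu2 - Var Mu3)"
  let ?H3 = "smul (1/4) (of_nat N - Var Mu1 - Var Mu2 + Var Mu3)"
  \<comment> \<open>Each of these combinations has eigenvalue 3 on one of \<open>X2\<close>,
    \<open>X3\<close>, \<open>X4\<close> and -1 on the other three eigenvectors, hence sends
    \<open>X\<close> to twice the distinguished one minus \<open>X\<close>.\<close>
  let ?G1 = "\<lambda>p. D1 p - D2 p - D3 p" and ?G2 = "\<lambda>p. D2 p - D1 p - D3 p" and ?G3 = "\<lambda>p. D3 p - D1 p - D2 p"
  have H: "subst_ops T ?H1 v = smul (1/4) (of_nat N * v + ?G1 v)"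
    "subst_ops T ?H2 v = smul (1/4) (of_nat N * v + ?G2 v)"
    "subst_ops T ?H3 v = smul (1/4) (of_nat N * v + ?G3 v)" for v
    by (simp_all add: subst_ops_smul subst_ops_add subst_ops_diff subst_ops_of_nat subst_ops_Var T_def
        algebra_simps)
  have G: "derivation ?G1" "derivation ?G2" "derivation ?G3"
    using D by (simp_all add: derivation_def smul_diff smul_add algebra_simps)
  have three: "3 * p = smul 3 p" and four: "4 * p = smul 4 p" for p :: P
    using of_nat_mult_eq_smul[of 3 p] of_nat_mult_eq_smul[of 4 p] by simp_all
  have DX: "D1 X = smul (1/2) (X1 + X2 - X3 - X4)" "D2 X = smul (1/2) (X1 - X2 + X3 - X4)"
    "D3 X = smul (1/2) (X1 - X2 - X3 + X4)"
    using D by (simp_all add: X derivation_smul derivation_add D1 D2 D3)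
  have halves: "smul 2 p = 4 * smul (1/2) p" for p :: P
    using four[of "smul (1/2) p"] by (simp add: smul_smult)
  have GX: "?G1 X = smul 2 X2 - X" "?G2 X = smul 2 X3 - X" "?G3 X = smul 2 X4 - X"
    unfolding DX by (simp_all add: X halves smul_add smul_diff algebra_simps)
  have G1: "?G1 X2 = smul 3 X2" "?G1 X3 = - X3" "?G1 X4 = - X4"
    and G2: "?G2 X3 = smul 3 X3" "?G2 X2 = - X2" "?G2 X4 = - X4"
    and G3: "?G3 X4 = smul 3 X4" "?G3 X2 = - X2" "?G3 X3 = - X3"
    by (simp_all add: D1 D2 D3 flip: three)
  have monomial: "subst_ops T
      (pochhammer (- Var Lam1) (a + b) * pochhammer (- Var Lam2) (c + d) * pochhammer (- Var Lam3) (e + f) *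
       pochhammer (- ?H1) (c + e) * pochhammer (- ?H2) (a + f) * pochhammer (- ?H3) (b + d)) (X ^ N)
    = smul (pochhammer (- of_nat s) (a + b) * pochhammer (- of_nat t) (c + d) * pochhammer (- of_nat u) (e + f)
        * (pochhammer (- of_nat N) (a + b + c + d + e + f) / 2 ^ (a + b + c + d + e + f)))
      (X ^ (N - (a + b + c + d + e + f)) * X2 ^ (c + e) * X3 ^ (a + f) * X4 ^ (b + d))"
    (is "_ = smul (_ * (?p / _)) _")
    if n: "a + b + c + d + e + f \<le> N" for a b c d e f
  proof -
    define i j k where "i = c + e" and "j = a + f" and "k = b + d"
    have n': "a + b + c + d + e + f = k + j + i" "k + j + i \<le> N"
      using n by (simp_all add: i_def j_def k_def)
    \<comment> \<open>The rightmost operator acts first. Each stage consumes powers of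
      \<open>X\<close> and leaves the total degree \<open>N\<close>, so the next stage starts from a
      smaller exponent of \<open>X\<close> and from a monomial free of its own variable.\<close>
    have 3: "subst_ops T (pochhammer (- ?H3) k) (X ^ N)
        = smul (pochhammer (- of_nat N) k / 2 ^ k) (X ^ (N - k) * X4 ^ k)"
      using pochhammer_partial_Euler[OF G(3) GX(3) G3 H(3), of N 0 0 k] by simp
    have 2: "subst_ops T (pochhammer (- ?H2) j) (X ^ (N - k) * X4 ^ k)
        = smul (pochhammer (- of_nat (N - k)) j / 2 ^ j) (X ^ (N - k - j) * X3 ^ j * X4 ^ k)"
      using pochhammer_partial_Euler[OF G(2) GX(2) G2 H(2), of "N - k" 0 k j] n' by simp
    have 1: "subst_ops T (pochhammer (- ?H1) i) (X ^ (N - k - j) * X3 ^ j * X4 ^ k)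
        = smul (pochhammer (- of_nat (N - k - j)) i / 2 ^ i) (X ^ (N - k - j - i) * X2 ^ i * X3 ^ j * X4 ^ k)"
      using pochhammer_partial_Euler[OF G(1) GX(1) G1 H(1), of "N - k - j" j k i] n' by simp
    \<comment> \<open>The shifted factorials concatenate, because each begins where the previous one
      stops: \<open>-(N - k) = -N + k\<close>, and likewise for \<open>k + j\<close>.\<close>
    have "?p = pochhammer (- of_nat N) k * pochhammer (- of_nat (N - k)) j * pochhammer (- of_nat (N - k - j)) i"
    proof -
      have "- of_nat (N - k) = (- of_nat N + of_nat k :: complex)"
        "- of_nat (N - k - j) = (- of_nat N + of_nat (k + j) :: complex)"
        using n'(2) by (simp_all add: of_nat_diff)
      then show ?thesis
        by (simp only: n'(1) pochhammer_product')
    qed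
    moreover have "subst_ops T (pochhammer (- Var Lam1) n) v = smul (pochhammer (- of_nat s) n) v"
      "subst_ops T (pochhammer (- Var Lam2) n) v = smul (pochhammer (- of_nat t) n) v"
      "subst_ops T (pochhammer (- Var Lam3) n) v = smul (pochhammer (- of_nat u) n) v" for n v
      by (rule subst_ops_pochhammer_scalar; simp add: T_def)+
    ultimately show ?thesis
      unfolding i_def[symmetric] j_def[symmetric] k_def[symmetric] n'(1) subst_ops_mult 1 2 3
        subst_ops_apply_smul
      by (simp add: smul_smult power_add mult_ac)
  qed
  have "calP_vee_op N (of_nat s) (of_nat t) (of_nat u) D1 D2 D3 (X ^ N)
    = (\<Sum>(a, b, c, d, e, f) \<in> {(a, b, c, d, e, f). a + b + c + d + e + f \<le> N}.
      smul (pochhammer (- of_nat s) (a + b) * pochhammer (- of_nat t) (c + d) * pochhammer (- of_nat u) (e + f)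
          / (fact a * fact b * fact c * fact d * fact e * fact f))
        (X ^ (N - (a + b + c + d + e + f)) * X2 ^ (c + e) * X3 ^ (a + f) * X4 ^ (b + d)))"
    unfolding calP_vee_op_def T_def[symmetric] calP_vee_def calP_def subst_ops_sum
  proof (rule sum.cong[OF refl], safe)
    fix a b c d e f :: nat
    assume n: "a + b + c + d + e + f \<le> N"
    \<comment> \<open>The bound by \<open>N\<close> keeps the denominator nonzero, so it cancels
      against the same shifted factorial produced by \<open>monomial\<close>.\<close>
    then have nz: "pochhammer (- of_nat N :: complex) (a + b + c + d + e + f) \<noteq> 0"
      by (simp add: pochhammer_of_nat_eq_0_iff)
    show "subst_ops T (smul
        (2 ^ (a + b + c + d + e + f) /
          (pochhammer (- of_nat N) (a + b + c + d + e + f) *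
            (fact a * fact b * fact c * fact d * fact e * fact f)))
        (pochhammer (- Var Lam1) (a + b) * pochhammer (- Var Lam2) (c + d) * pochhammer (- Var Lam3) (e + f) *
         pochhammer (- ?H1) (c + e) * pochhammer (- ?H2) (a + f) * pochhammer (- ?H3) (b + d))) (X ^ N)
      = smul (pochhammer (- of_nat s) (a + b) * pochhammer (- of_nat t) (c + d) * pochhammer (- of_nat u) (e + f)
          / (fact a * fact b * fact c * fact d * fact e * fact f))
        (X ^ (N - (a + b + c + d + e + f)) * X2 ^ (c + e) * X3 ^ (a + f) * X4 ^ (b + d))"
      unfolding subst_ops_smul monomial[OF n] smul_smult
      using nz by (intro arg_cong[where f = "\<lambda>z. smul z _"]) (simp add: field_simps)
  qed
  also have "\<dots> = X ^ r * (X - X3 - X4) ^ s * (X - X2 - X4) ^ t * (X - X2 - X3) ^ u"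
    by (rule sum_trinomial_pochhammer_product[OF N])
  finally show ?thesis .
qed

section \<open>The two coordinate systems and the six matrices\<close>

text \<open>The coordinate change is half a symmetric Hadamard matrix of order 4, hence an
  involution, and either system arises from the other by the same formulas. The differences are
  written in the shape delivered by \<open>calP_vee_op_power\<close>.\<close>

lemma vx_eq: "vx = smul (1/2) (vxs + vys + vzs + vws)"
  and vy_eq: "vy = vx - vzs - vws"
  and vz_eq: "vz = vx - vys - vws"
  and vw_eq: "vw = vx - vys - vzs"
  and vys_eq: "vys = vxs - vz - vw"
  and vzs_eq: "vzs = vxs - vy - vw"
  and vws_eq: "vws = vxs - vy - vz"
proof -
  have two: "2 * p = smul 2 p" and four: "4 * p = smul 4 p" for p :: P
    using of_nat_mult_eq_smul[of 2 p] of_nat_mult_eq_smul[of 4 p] by simp_all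
  show "vx = smul (1/2) (vxs + vys + vzs + vws)"
    by (simp add: vxs_def vys_def vzs_def vws_def smul_add smul_diff smul_smult four)
  show "vy = vx - vzs - vws" "vz = vx - vys - vws" "vw = vx - vys - vzs"
    "vys = vxs - vz - vw" "vzs = vxs - vy - vw" "vws = vxs - vy - vz"
    by (simp_all add: vxs_def vys_def vzs_def vws_def smul_add smul_diff smul_smult algebra_simps two)
qed

lemma act_A:
  "act A1 vx = vy" "act A1 vy = vx" "act A1 vz = vw" "act A1 vw = vz"
  "act A2 vx = vz" "act A2 vy = vw" "act A2 vz = vx" "act A2 vw = vy"
  "act A3 vx = vw" "act A3 vy = vz" "act A3 vz = vy" "act A3 vw = vx"
  by (simp_all add: vx_def vy_def vz_def vw_def act_Var sum_4 A1_def A2_def A3_def E_def)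

lemma act_As:
  "act A1s vx = vx" "act A1s vy = vy" "act A1s vz = - vz" "act A1s vw = - vw"
  "act A2s vx = vx" "act A2s vy = - vy" "act A2s vz = vz" "act A2s vw = - vw"
  "act A3s vx = vx" "act A3s vy = - vy" "act A3s vz = - vz" "act A3s vw = vw"
  by (simp_all add: vx_def vy_def vz_def vw_def act_Var sum_4 A1s_def A2s_def A3s_def E_def
      smul_minus_left)

lemma act_diff_right: "act \<phi> (p - q) = act \<phi> p - act \<phi> q"
  using act_add_right[of \<phi> p "smul (- 1) q"] act_smult_right[of \<phi> "- 1" q]
  by (simp add: smul_minus_left)

text \<open>The matrices \<open>A1\<close>, \<open>A2\<close>, \<open>A3\<close> permute the plain
  coordinates by double transpositions, and the starred coordinates diagonalize them simultaneously.
  The signs agree with those in \<open>act_As\<close>, so one evaluation serves both claims.\<close>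

lemma act_A_star:
  "act A1 vxs = vxs" "act A1 vys = vys" "act A1 vzs = - vzs" "act A1 vws = - vws"
  "act A2 vxs = vxs" "act A2 vys = - vys" "act A2 vzs = vzs" "act A2 vws = - vws"
  "act A3 vxs = vxs" "act A3 vys = - vys" "act A3 vzs = - vzs" "act A3 vws = vws"
  by (simp_all add: vxs_def vys_def vzs_def vws_def act_smult_right act_add_right act_diff_right act_A
      smul_add smul_diff)

theorem proposition10p10:
  fixes N :: nat
  shows "\<forall>r s t u :: nat. r + s + t + u = N \<longrightarrow>
    calP_vee_op N (of_nat s) (of_nat t) (of_nat u) (act A1) (act A2) (act A3) (vx ^ N)
      = vx ^ r * vy ^ s * vz ^ t * vw ^ u \<and>
    calP_vee_op N (of_nat s) (of_nat t) (of_nat u) (act A1s) (act A2s) (act A3s) (vxs ^ N)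
      = vxs ^ r * vys ^ s * vzs ^ t * vws ^ u"
proof (intro allI impI conjI)
  fix r s t u :: nat
  assume N: "r + s + t + u = N"
  show "calP_vee_op N (of_nat s) (of_nat t) (of_nat u) (act A1) (act A2) (act A3) (vx ^ N)
      = vx ^ r * vy ^ s * vz ^ t * vw ^ u"
    \<comment> \<open>Here \<open>X\<close> is \<open>vx\<close> and the eigenvectors are the
      starred coordinates; in the second claim the two systems exchange roles.\<close>
    unfolding vy_eq vz_eq vw_eq
    by (rule calP_vee_op_power[OF _ _ _ _ _ _ act_A_star vx_eq N])
      (simp_all add: derivation_act act_commute A_commute)
  show "calP_vee_op N (of_nat s) (of_nat t) (of_nat u) (act A1s) (act A2s) (act A3s) (vxs ^ N)
      = vxs ^ r * vys ^ s * vzs ^ t * vws ^ u"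
    unfolding vys_eq vzs_eq vws_eq
    by (rule calP_vee_op_power[OF _ _ _ _ _ _ act_As vxs_def N])
      (simp_all add: derivation_act act_commute A_commute)
qed

end
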